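(* In the locker room problem with $n$ lockers, with the sought number $s$ chosen uniformly at random from $\{0,\dots,n-1\}$ independently of the placement of the cards, the optimal (maximum over all strategies of Alice and Bob) probability $\Pr[\mathcal V(\mathrm{CLR})]$ that Bob finds card $s$ satisfies $$\Pr[\mathcal V(\mathrm{CLR})]\le\frac{(4+o(1))\,\log n}{n\,\log\log n},$$ where $o(1)$ denotes a quantity depending only on $n$ and tending to $0$ as $n\to\infty$.
   Context: $\log=\log_2$. Locker room problem (CLR protocol): there are $n$ lockers numbered $0,\dots,n-1$, into which $n$ cards numbered $0,\dots,n-1$ are placed, one per locker, according to a uniformly random permutation $\sigma$ (locker $\ell$ contains card $\sigma(\ell)$). Alice sees the contents of all lockers and may then swap the cards of one pair of lockers, or leave everything unchanged; she does not know $s$. Then Bob, who does not know $\sigma$, is given $s\in\{0,\dots,n-1\}$ and may open at most two lockers, the choice of the second being allowed to depend on $s$ and on the card seen in the first. Bob succeeds if one of the opened lockers contains card $s$. Alice and Bob agree on a strategy (Alice's swap as a function of $\sigma$; Bob's first locker as a function of $s$; Bob's second locker as a function of $s$ and the card seen in the first locker) beforehand. *)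

theory Defs
  imports "HOL-Probability.Probability" "HOL-Combinatorics.Permutations"
begin

definition placements :: "nat \<Rightarrow> (nat \<Rightarrow> nat) set" where
  "placements n = {\<sigma>. \<sigma> permutes {..<n}}"

(* Alice answers a pair of lockers; a pair (i, i) means that nothing is changed. *)
definition alice_strategies :: "nat \<Rightarrow> ((nat \<Rightarrow> nat) \<Rightarrow> nat \<times> nat) set" where
  "alice_strategies n = placements n \<rightarrow>\<^sub>E {..<n} \<times> {..<n}"

definition bob_first_strategies :: "nat \<Rightarrow> (nat \<Rightarrow> nat) set" where
  "bob_first_strategies n = {..<n} \<rightarrow>\<^sub>E {..<n}"

(* First argument: the sought number; second argument: the card seen in the first locker.
   Answering the first locker again amounts to opening only one. *)
definition bob_second_strategies :: "nat \<Rightarrow> (nat \<Rightarrow> nat \<Rightarrow> nat) set" where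
  "bob_second_strategies n = {..<n} \<rightarrow>\<^sub>E ({..<n} \<rightarrow>\<^sub>E {..<n})"

definition clr_strategies ::
  "nat \<Rightarrow> (((nat \<Rightarrow> nat) \<Rightarrow> nat \<times> nat) \<times> (nat \<Rightarrow> nat) \<times> (nat \<Rightarrow> nat \<Rightarrow> nat)) set" where
  "clr_strategies n = alice_strategies n \<times> bob_first_strategies n \<times> bob_second_strategies n"

definition after_swap :: "(nat \<Rightarrow> nat) \<Rightarrow> nat \<times> nat \<Rightarrow> nat \<Rightarrow> nat" where
  "after_swap \<sigma> p = \<sigma> \<circ> Transposition.transpose (fst p) (snd p)"

definition bob_finds :: "(nat \<Rightarrow> nat) \<Rightarrow> (nat \<Rightarrow> nat \<Rightarrow> nat) \<Rightarrow> (nat \<Rightarrow> nat) \<Rightarrow> nat \<Rightarrow> bool" where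
  "bob_finds b1 b2 \<tau> s \<longleftrightarrow> \<tau> (b1 s) = s \<or> \<tau> (b2 s (\<tau> (b1 s))) = s"

definition success_prob ::
  "nat \<Rightarrow> ((nat \<Rightarrow> nat) \<Rightarrow> nat \<times> nat) \<times> (nat \<Rightarrow> nat) \<times> (nat \<Rightarrow> nat \<Rightarrow> nat) \<Rightarrow> real" where
  "success_prob n = (\<lambda>(a, b1, b2).
     measure_pmf.prob (pair_pmf (pmf_of_set (placements n)) (pmf_of_set {..<n}))
       {(\<sigma>, s). bob_finds b1 b2 (after_swap \<sigma> (a \<sigma>)) s})"

definition clr_opt_prob :: "nat \<Rightarrow> real" where
  "clr_opt_prob n = Max (success_prob n ` clr_strategies n)"

(* For n > 0 the maximum is thus taken over a finite nonempty set. *)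

lemma finite_clr_strategies: "finite (clr_strategies n)"
  by (auto simp: clr_strategies_def alice_strategies_def bob_first_strategies_def
      bob_second_strategies_def placements_def intro!: finite_PiE finite_permutations)

lemma clr_strategies_nonempty: "n > 0 \<Longrightarrow> clr_strategies n \<noteq> {}"
  by (auto simp: clr_strategies_def alice_strategies_def bob_first_strategies_def
      bob_second_strategies_def PiE_eq_empty_iff)

end

theory Submission
  imports Defs "HOL-Real_Asymp.Real_Asymp"
begin

text \<open>
  Fix Bob's strategy. Write \<open>b1 s\<close> for the first locker he opens and call \<open>\<tau> (b1 s)\<close> the card
  to which \<open>s\<close> points. Every found card points to a card that is at most \<open>s\<close> or at least \<open>s\<close>.
  Hence, if \<open>2 m\<close> cards are found, then for one of the two orders there are \<open>m\<close> found cards that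
  never point strictly upwards in that order. Looking these up in increasing order, Bob always
  finds the next card in a locker which has not been opened before, so for a fixed set of \<open>m\<close>
  cards and a uniformly random \<open>\<tau>\<close> this has probability at most \<open>(2 / (n - 2 m)) ^ m\<close>. (Without
  the order, a single cycle of pointers could produce many finds for free.) Therefore the expected
  number of such \<open>m\<close>-subsets is about \<open>2 ^ m / fact m\<close>. A placement after a fixed swap is again
  uniformly random, so summing over the \<open>n\<^sup>2\<close> swaps costs a factor \<open>n\<^sup>2\<close>, which is absorbed
  as soon as \<open>m\<close> is slightly larger than \<open>2 log n / log log n\<close>; Bob then finds about \<open>2 m\<close> cards.
\<close>

section \<open>Permutations conditioned on the contents of the opened lockers\<close>

text \<open>This is the event that opening the lockers in \<open>D\<close> has shown the cards given
  by \<rho>. Ratios of cardinalities stand in for conditional probabilities.\<close>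

definition agreeing_perms :: "'a set \<Rightarrow> 'a set \<Rightarrow> ('a \<Rightarrow> 'a) \<Rightarrow> ('a \<Rightarrow> 'a) set" where
  "agreeing_perms U D \<rho> = {\<tau>. \<tau> permutes U \<and> (\<forall>x\<in>D. \<tau> x = \<rho> x)}"

lemma finite_agreeing_perms: "finite U \<Longrightarrow> finite (agreeing_perms U D \<rho>)"
  by (rule finite_subset[OF _ finite_permutations]) (auto simp: agreeing_perms_def)

lemma agreeing_perms_insert:
  assumes "\<rho>' \<in> agreeing_perms U D \<rho>"
  shows "agreeing_perms U (insert x D) \<rho>' = {\<tau> \<in> agreeing_perms U D \<rho>. \<tau> x = \<rho>' x}"
  using assms by (auto simp: agreeing_perms_def)

text \<open>Given the seen cards, all unseen cards are equally likely to lie in an unopened locker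
  \<open>x\<close>: exchanging \<open>v\<close> with another unseen card \<open>w\<close> maps the
  permutations with \<open>v\<close> in \<open>x\<close> injectively to those with \<open>w\<close>
  in \<open>x\<close>. At least \<open>card U - card D\<close> cards are unseen, and the resulting
  events are disjoint.\<close>

lemma card_agreeing_perms_hit:
  assumes U: "finite U" and D: "finite D" and x: "x \<notin> D" and v: "v \<in> U"
  shows "card {\<tau> \<in> agreeing_perms U D \<rho>. \<tau> x = v} * (card U - card D) \<le> card (agreeing_perms U D \<rho>)"
proof (cases "{\<tau> \<in> agreeing_perms U D \<rho>. \<tau> x = v} = {}")
  case True
  then show ?thesis by (metis card.empty mult_0 zero_le)
next
  case False
  define Q where "Q = agreeing_perms U D \<rho>"
  define W where "W = U - \<rho> ` D"
  have finQ: "finite Q" unfolding Q_def by (rule finite_agreeing_perms[OF U])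
  obtain \<tau>0 where \<tau>0: "\<tau>0 permutes U" "\<forall>d\<in>D. \<tau>0 d = \<rho> d" "\<tau>0 x = v"
    using False by (auto simp: agreeing_perms_def)
  have xU: "x \<in> U" using \<tau>0 v by (metis permutes_in_image)
  \<comment> \<open>As \<open>v\<close> lies in the unopened locker \<open>x\<close>, it has not
    been seen, so the transpositions below leave every seen card in place.\<close>
  have vD: "v \<notin> \<rho> ` D"
    using \<tau>0 x by (metis imageE permutes_inj inj_eq)
  have le: "card {\<tau> \<in> Q. \<tau> x = v} \<le> card {\<tau> \<in> Q. \<tau> x = w}" if w: "w \<in> W" for w
  proof (rule card_inj_on_le[where f = "\<lambda>\<tau>. Transposition.transpose v w \<circ> \<tau>"])
    show "inj_on (\<lambda>\<tau>. Transposition.transpose v w \<circ> \<tau>) {\<tau> \<in> Q. \<tau> x = v}"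
      by (intro inj_onI) (metis comp_assoc id_comp transpose_comp_involutory)
    have "Transposition.transpose v w permutes U"
      using v w by (intro permutes_swap_id) (auto simp: W_def)
    moreover have "Transposition.transpose v w (\<rho> d) = \<rho> d" if "d \<in> D" for d
      using that vD w by (intro transpose_apply_other) (auto simp: W_def)
    ultimately show "(\<lambda>\<tau>. Transposition.transpose v w \<circ> \<tau>) ` {\<tau> \<in> Q. \<tau> x = v} \<subseteq> {\<tau> \<in> Q. \<tau> x = w}"
      by (auto simp: Q_def agreeing_perms_def intro: permutes_compose)
    show "finite {\<tau> \<in> Q. \<tau> x = w}" using finQ by simp
  qed
  have "card U - card D \<le> card W"
    unfolding W_def using card_image_le[OF D, of \<rho>] diff_card_le_card_Diff[of "\<rho> ` D" U] D
    by simp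
  then have "card {\<tau> \<in> Q. \<tau> x = v} * (card U - card D) \<le> (\<Sum>w\<in>W. card {\<tau> \<in> Q. \<tau> x = v})"
    by simp
  also have "\<dots> \<le> (\<Sum>w\<in>W. card {\<tau> \<in> Q. \<tau> x = w})"
    by (intro sum_mono le)
  also have "\<dots> = card (\<Union>w\<in>W. {\<tau> \<in> Q. \<tau> x = w})"
    using finQ U by (subst card_UN_disjoint) (auto simp: W_def)
  also have "\<dots> \<le> card Q"
    using finQ by (intro card_mono) auto
  finally show ?thesis unfolding Q_def .
qed

text \<open>Law of total probability over the card in locker \<open>x\<close>. It allows Bob's first
  card to be fixed before his second locker, which depends on it, is examined.\<close>

lemma card_agreeing_perms_refine:
  assumes U: "finite U"
    and step: "\<And>\<rho>'. \<rho>' \<in> agreeing_perms U D \<rho> \<Longrightarrow>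
      card {\<tau> \<in> agreeing_perms U (insert x D) \<rho>'. P \<tau>} * a \<le> b * card (agreeing_perms U (insert x D) \<rho>')"
  shows "card {\<tau> \<in> agreeing_perms U D \<rho>. P \<tau>} * a \<le> b * card (agreeing_perms U D \<rho>)"
proof -
  define Q where "Q = agreeing_perms U D \<rho>"
  define C where "C = (\<lambda>\<tau>. \<tau> x) ` Q"
  have finQ: "finite Q" unfolding Q_def by (rule finite_agreeing_perms[OF U])
  have "{\<tau> \<in> Q. P \<tau>} = (\<Union>c\<in>C. {\<tau> \<in> Q. \<tau> x = c \<and> P \<tau>})" "Q = (\<Union>c\<in>C. {\<tau> \<in> Q. \<tau> x = c})"
    by (auto simp: C_def)
  then have "card {\<tau> \<in> Q. P \<tau>} = card (\<Union>c\<in>C. {\<tau> \<in> Q. \<tau> x = c \<and> P \<tau>})"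
    "card Q = card (\<Union>c\<in>C. {\<tau> \<in> Q. \<tau> x = c})" by simp_all
  moreover have "card (\<Union>c\<in>C. {\<tau> \<in> Q. \<tau> x = c \<and> P \<tau>}) = (\<Sum>c\<in>C. card {\<tau> \<in> Q. \<tau> x = c \<and> P \<tau>})"
    using finQ by (subst card_UN_disjoint) (auto simp: C_def)
  moreover have "card (\<Union>c\<in>C. {\<tau> \<in> Q. \<tau> x = c}) = (\<Sum>c\<in>C. card {\<tau> \<in> Q. \<tau> x = c})"
    using finQ by (subst card_UN_disjoint) (auto simp: C_def)
  moreover have "card {\<tau> \<in> Q. \<tau> x = c \<and> P \<tau>} * a \<le> b * card {\<tau> \<in> Q. \<tau> x = c}" if c: "c \<in> C" for c
  proof -
    obtain \<rho>' where \<rho>': "\<rho>' \<in> Q" "c = \<rho>' x" using c unfolding C_def by blast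
    have "{\<tau> \<in> agreeing_perms U (insert x D) \<rho>'. P \<tau>} = {\<tau> \<in> Q. \<tau> x = c \<and> P \<tau>}"
      using \<rho>' by (auto simp: agreeing_perms_insert[of \<rho>' U D \<rho> x] Q_def)
    then show ?thesis
      using step[of \<rho>'] \<rho>' agreeing_perms_insert[of \<rho>' U D \<rho> x] by (simp add: Q_def)
  qed
  ultimately show ?thesis
    unfolding Q_def[symmetric] by (simp add: sum_distrib_left sum_distrib_right sum_mono)
qed

section \<open>Finding a fixed set of cards in a monotone order\<close>

definition ordered_find :: "(nat \<Rightarrow> nat \<Rightarrow> bool) \<Rightarrow> (nat \<Rightarrow> nat) \<Rightarrow> (nat \<Rightarrow> nat \<Rightarrow> nat) \<Rightarrow>
    (nat \<Rightarrow> nat) \<Rightarrow> nat \<Rightarrow> bool" where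
  "ordered_find R b1 b2 \<tau> s \<longleftrightarrow> bob_finds b1 b2 \<tau> s \<and> (\<tau> (b1 s) = s \<or> R (\<tau> (b1 s)) s)"

text \<open>
  Here \<open>D\<close> is the set of lockers opened so far, all of which contain cards that precede the cards
  in \<open>xs\<close>; this invariant is what guarantees that each find happens in an unopened locker.
\<close>

lemma card_ordered_find_list:
  assumes U: "finite U" and trans: "transp R" and irr: "irreflp R"
  shows "\<lbrakk>sorted_wrt R xs; set xs \<subseteq> U; finite D; \<And>d s. d \<in> D \<Longrightarrow> s \<in> set xs \<Longrightarrow> R (\<rho> d) s;
      M + card D + 2 * length xs \<le> card U\<rbrakk> \<Longrightarrow>
    card {\<tau> \<in> agreeing_perms U D \<rho>. \<forall>s\<in>set xs. ordered_find R b1 b2 \<tau> s} * M ^ length xs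
      \<le> 2 ^ length xs * card (agreeing_perms U D \<rho>)"
proof (induction xs arbitrary: D \<rho>)
  case Nil
  then show ?case by simp
next
  case (Cons s xs)
  define P where "P = (\<lambda>\<tau>. \<forall>s\<in>set xs. ordered_find R b1 b2 \<tau> s)"
  have sU: "s \<in> U" and sR: "\<And>s'. s' \<in> set xs \<Longrightarrow> R s s'" using Cons.prems by auto
  \<comment> \<open>Cost of one find: the hit on \<open>s\<close> contributes a factor
    \<open>1 / M\<close>, and the induction hypothesis handles \<open>xs\<close>. The set
    \<open>D'\<close> will be \<open>D\<close>, possibly with Bob's first locker added. With
    \<open>y\<close> this makes at most two new lockers per card, which explains the term
    \<open>2 * length xs\<close> in the budget.\<close>
  have hit: "card {\<tau> \<in> agreeing_perms U D' \<rho>'. \<tau> y = s \<and> P \<tau>} * M ^ Suc (length xs)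
      \<le> 2 ^ length xs * card (agreeing_perms U D' \<rho>')"
    if D': "finite D'" "card D' \<le> Suc (card D)" "\<And>d. d \<in> D' \<Longrightarrow> R (\<rho>' d) s" for D' \<rho>' y
  proof (cases "{\<tau> \<in> agreeing_perms U D' \<rho>'. \<tau> y = s \<and> P \<tau>} = {}")
    case True
    then show ?thesis by (metis card.empty mult_0 zero_le)
  next
    case False
    then obtain \<rho>2 where \<rho>2: "\<rho>2 \<in> agreeing_perms U D' \<rho>'" "\<rho>2 y = s" by blast
    \<comment> \<open>Opened lockers hold cards strictly preceding \<open>s\<close>, whereas
      \<open>y\<close> holds \<open>s\<close> itself.\<close>
    have y: "y \<notin> D'"
      using \<rho>2 D'(3)[of y] irr by (auto simp: agreeing_perms_def irreflp_def)
    have R2: "R (\<rho>2 d) s'" if "d \<in> insert y D'" "s' \<in> set xs" for d s'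
    proof (cases "d = y")
      case True
      then show ?thesis using \<rho>2 sR that by simp
    next
      case False
      then have "R (\<rho>2 d) s" using \<rho>2 D'(3) that by (auto simp: agreeing_perms_def)
      then show ?thesis using sR[OF that(2)] trans by (blast dest: transpD)
    qed
    have eq: "agreeing_perms U (insert y D') \<rho>2 = {\<tau> \<in> agreeing_perms U D' \<rho>'. \<tau> y = s}"
      using agreeing_perms_insert[OF \<rho>2(1)] \<rho>2(2) by simp
    have eqP: "{\<tau> \<in> agreeing_perms U D' \<rho>'. \<tau> y = s \<and> P \<tau>} =
        {\<tau> \<in> agreeing_perms U (insert y D') \<rho>2. P \<tau>}"
      by (auto simp: eq)
    have "card {\<tau> \<in> agreeing_perms U (insert y D') \<rho>2. P \<tau>} * M ^ length xs
        \<le> 2 ^ length xs * card (agreeing_perms U (insert y D') \<rho>2)"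
      unfolding P_def
    proof (rule Cons.IH)
      show "R (\<rho>2 d) s'" if "d \<in> insert y D'" "s' \<in> set xs" for d s' using R2 that .
    qed (use Cons.prems D' y in auto)
    then have "card {\<tau> \<in> agreeing_perms U D' \<rho>'. \<tau> y = s \<and> P \<tau>} * M ^ length xs
        \<le> 2 ^ length xs * card {\<tau> \<in> agreeing_perms U D' \<rho>'. \<tau> y = s}"
      by (simp only: eqP eq)
    then have "card {\<tau> \<in> agreeing_perms U D' \<rho>'. \<tau> y = s \<and> P \<tau>} * M ^ length xs * M
        \<le> 2 ^ length xs * card {\<tau> \<in> agreeing_perms U D' \<rho>'. \<tau> y = s} * M"
      by (rule mult_le_mono1)
    also have "\<dots> \<le> 2 ^ length xs * (card {\<tau> \<in> agreeing_perms U D' \<rho>'. \<tau> y = s} * (card U - card D'))"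
    proof -
      have "M \<le> card U - card D'" using Cons.prems(5) D'(2) by simp
      then show ?thesis by simp
    qed
    also have "\<dots> \<le> 2 ^ length xs * card (agreeing_perms U D' \<rho>')"
      by (intro mult_le_mono2 card_agreeing_perms_hit U D' y sU)
    finally show ?thesis by (simp add: mult.assoc mult.commute)
  qed
  \<comment> \<open>The card \<open>s\<close> is found either in the first locker or in the second
    one after a preceding card. Each case costs one hit, whence the factor 2 per card.\<close>
  define A1 where "A1 = {\<tau> \<in> agreeing_perms U D \<rho>. \<tau> (b1 s) = s \<and> P \<tau>}"
  define A2 where "A2 = {\<tau> \<in> agreeing_perms U D \<rho>.
    R (\<tau> (b1 s)) s \<and> \<tau> (b2 s (\<tau> (b1 s))) = s \<and> P \<tau>}"
  have fin: "finite A1" "finite A2"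
    using finite_agreeing_perms[OF U, of D \<rho>] by (auto simp: A1_def A2_def)
  have A1: "card A1 * M ^ Suc (length xs) \<le> 2 ^ length xs * card (agreeing_perms U D \<rho>)"
    unfolding A1_def by (rule hit) (use Cons.prems in auto)
  \<comment> \<open>Once the card in \<open>b1 s\<close> is fixed, the second locker is a fixed
    locker \<open>?y\<close> and \<open>hit\<close> applies. If that card does not precede
    \<open>s\<close>, the event is empty.\<close>
  have A2: "card A2 * M ^ Suc (length xs) \<le> 2 ^ length xs * card (agreeing_perms U D \<rho>)"
    unfolding A2_def
  proof (rule card_agreeing_perms_refine[where x = "b1 s", OF U])
    fix \<rho>' assume \<rho>': "\<rho>' \<in> agreeing_perms U D \<rho>"
    let ?D = "insert (b1 s) D" and ?y = "b2 s (\<rho>' (b1 s))"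
    let ?A = "{\<tau> \<in> agreeing_perms U ?D \<rho>'. R (\<tau> (b1 s)) s \<and> \<tau> (b2 s (\<tau> (b1 s))) = s \<and> P \<tau>}"
    show "card ?A * M ^ Suc (length xs) \<le> 2 ^ length xs * card (agreeing_perms U ?D \<rho>')"
    proof (cases "R (\<rho>' (b1 s)) s")
      case True
      have "?A = {\<tau> \<in> agreeing_perms U ?D \<rho>'. \<tau> ?y = s \<and> P \<tau>}"
        using True by (auto simp: agreeing_perms_def)
      moreover have "R (\<rho>' d) s" if "d \<in> ?D" for d
        using that True \<rho>' Cons.prems(4) by (auto simp: agreeing_perms_def)
      ultimately show ?thesis
        using hit[of ?D \<rho>' ?y] Cons.prems(3) by (simp add: card_insert_if)
    next
      case False
      then have "?A = {}" by (auto simp: agreeing_perms_def)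
      then show ?thesis by (metis card.empty mult_0 zero_le)
    qed
  qed
  have "{\<tau> \<in> agreeing_perms U D \<rho>. \<forall>s\<in>set (s # xs). ordered_find R b1 b2 \<tau> s} \<subseteq> A1 \<union> A2"
    by (auto simp: A1_def A2_def P_def ordered_find_def bob_finds_def)
  then have "card {\<tau> \<in> agreeing_perms U D \<rho>. \<forall>s\<in>set (s # xs). ordered_find R b1 b2 \<tau> s}
      \<le> card A1 + card A2"
    using fin by (meson card_Un_le card_mono finite_UnI order_trans)
  then have "card {\<tau> \<in> agreeing_perms U D \<rho>. \<forall>s\<in>set (s # xs). ordered_find R b1 b2 \<tau> s} * M ^ Suc (length xs)
      \<le> (card A1 + card A2) * M ^ Suc (length xs)"
    by (rule mult_le_mono1)
  also have "\<dots> \<le> 2 ^ length xs * card (agreeing_perms U D \<rho>) + 2 ^ length xs * card (agreeing_perms U D \<rho>)"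
    using A1 A2 by (simp add: add_mult_distrib)
  finally show ?case by (simp add: mult.assoc)
qed

lemma card_ordered_find_set:
  assumes R: "R = (<) \<or> R = (>)" and S: "S \<subseteq> {..<n}" and n: "2 * card S \<le> n"
  shows "card {\<tau>. \<tau> permutes {..<n} \<and> (\<forall>s\<in>S. ordered_find R b1 b2 \<tau> s)} * (n - 2 * card S) ^ card S
    \<le> 2 ^ card S * fact n"
proof -
  have fin: "finite S" using S finite_subset by blast
  \<comment> \<open>The lookups must increase with respect to \<open>R\<close>, so the list is
    reversed for \<open>(>)\<close>.\<close>
  define xs where "xs = (if R = (<) then sorted_list_of_set S else rev (sorted_list_of_set S))"
  have xs: "sorted_wrt R xs" "set xs = S" "length xs = card S"
    using R fin strict_sorted_list_of_set[of S]
    by (auto simp: xs_def sorted_wrt_rev)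
  have tr: "transp R" "irreflp R" using R by (auto simp: transp_def irreflp_def)
  have "card (agreeing_perms {..<n} {} id) = fact n"
    using card_permutations[of "{..<n}" n] by (simp add: agreeing_perms_def)
  moreover have "{\<tau> \<in> agreeing_perms {..<n} {} id. \<forall>s\<in>set xs. ordered_find R b1 b2 \<tau> s} =
    {\<tau>. \<tau> permutes {..<n} \<and> (\<forall>s\<in>S. ordered_find R b1 b2 \<tau> s)}"
    by (auto simp: agreeing_perms_def xs)
  ultimately show ?thesis
    using card_ordered_find_list[of "{..<n}" R xs "{}" id "n - 2 * card S" b1 b2] xs tr S n
    by simp
qed

section \<open>Expected number of found subsets and of found cards\<close>

text \<open>First moment method: the binomial coefficient counts the \<open>m\<close>-sets
  consisting of ordered finds, and exchanging the two sums reduces the claim to the bound for each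
  fixed set.\<close>

lemma sum_choose_ordered_find:
  assumes R: "R = (<) \<or> R = (>)" and n: "2 * m \<le> n"
  shows "(\<Sum>\<tau>\<in>placements n. card {s \<in> {..<n}. ordered_find R b1 b2 \<tau> s} choose m) * (n - 2 * m) ^ m
    \<le> (n choose m) * 2 ^ m * fact n"
proof -
  define A where "A \<tau> = {s \<in> {..<n}. ordered_find R b1 b2 \<tau> s}" for \<tau>
  define \<S> where "\<S> = {S. S \<subseteq> {..<n} \<and> card S = m}"
  have fin: "finite (placements n)" "finite \<S>"
    by (auto simp: placements_def \<S>_def finite_permutations)
  have "(\<Sum>\<tau>\<in>placements n. card (A \<tau>) choose m) = (\<Sum>\<tau>\<in>placements n. \<Sum>S\<in>\<S>. if S \<subseteq> A \<tau> then 1 else 0)"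
  proof (rule sum.cong[OF refl])
    fix \<tau>
    have "{S \<in> \<S>. S \<subseteq> A \<tau>} = {S. S \<subseteq> A \<tau> \<and> card S = m}"
      by (auto simp: \<S>_def A_def)
    moreover have "finite (A \<tau>)" by (simp add: A_def)
    ultimately have "card (A \<tau>) choose m = card {S \<in> \<S>. S \<subseteq> A \<tau>}" by (simp add: n_subsets)
    then show "card (A \<tau>) choose m = (\<Sum>S\<in>\<S>. if S \<subseteq> A \<tau> then 1 else 0)"
      using fin by (simp add: sum.If_cases Int_def)
  qed
  also have "\<dots> = (\<Sum>S\<in>\<S>. card {\<tau> \<in> placements n. S \<subseteq> A \<tau>})"
    using fin by (subst sum.swap) (simp add: sum.If_cases Int_def)
  finally have "(\<Sum>\<tau>\<in>placements n. card (A \<tau>) choose m) * (n - 2 * m) ^ m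
      = (\<Sum>S\<in>\<S>. card {\<tau> \<in> placements n. S \<subseteq> A \<tau>} * (n - 2 * m) ^ m)"
    by (simp add: sum_distrib_right)
  also have "\<dots> \<le> (\<Sum>S\<in>\<S>. 2 ^ m * fact n)"
  proof (rule sum_mono)
    fix S assume S: "S \<in> \<S>"
    then have "{\<tau> \<in> placements n. S \<subseteq> A \<tau>} =
        {\<tau>. \<tau> permutes {..<n} \<and> (\<forall>s\<in>S. ordered_find R b1 b2 \<tau> s)}"
      by (auto simp: placements_def A_def \<S>_def)
    then show "card {\<tau> \<in> placements n. S \<subseteq> A \<tau>} * (n - 2 * m) ^ m \<le> 2 ^ m * fact n"
      using card_ordered_find_set[OF R, of S n b1 b2] S n by (simp add: \<S>_def)
  qed
  also have "\<dots> = (n choose m) * 2 ^ m * fact n"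
    using n_subsets[of "{..<n}" m] by (simp add: \<S>_def)
  finally show ?thesis unfolding A_def .
qed

text \<open>By Pascal's rule, beyond \<open>k = m\<close> the coefficient grows by at least 1
  whenever \<open>k\<close> does. This linear bound controls the expected number of finds directly,
  without a tail estimate.\<close>

lemma le_add_choose:
  assumes "m > 0"
  shows "k \<le> m + (k choose m)"
proof (cases "k < Suc m")
  case False
  have "j \<le> (m + j) choose m" for j
  proof (induction j)
    case (Suc j)
    have "m + j choose (m - 1) > 0" by simp
    moreover have "m + Suc j choose m = (m + j choose (m - 1)) + (m + j choose m)"
      using assms by (cases m) auto
    ultimately show ?case using Suc by linarith
  qed simp
  from this[of "k - m"] show ?thesis using False by simp
qed simp

text \<open>Two cards are always comparable, so every find is ordered for \<open>(<)\<close> or for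
  \<open>(>)\<close>. Using both orders yields \<open>2 * m\<close> and thereby turns the 2 in the
  size of \<open>m\<close> into the final constant 4.\<close>

lemma card_found_le:
  assumes "m > 0"
  shows "card {s \<in> {..<n}. bob_finds b1 b2 \<tau> s} \<le> 2 * m
    + (card {s \<in> {..<n}. ordered_find (<) b1 b2 \<tau> s} choose m)
    + (card {s \<in> {..<n}. ordered_find (>) b1 b2 \<tau> s} choose m)"
proof -
  let ?A = "{s \<in> {..<n}. ordered_find (<) b1 b2 \<tau> s}" and ?B = "{s \<in> {..<n}. ordered_find (>) b1 b2 \<tau> s}"
  have "{s \<in> {..<n}. bob_finds b1 b2 \<tau> s} = ?A \<union> ?B"
    by (auto simp: ordered_find_def)
  then have "card {s \<in> {..<n}. bob_finds b1 b2 \<tau> s} \<le> card ?A + card ?B"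
    by (simp add: card_Un_le)
  then show ?thesis
    using le_add_choose[OF assms, of "card ?A"] le_add_choose[OF assms, of "card ?B"] by linarith
qed

lemma sum_after_swap:
  fixes f :: "(nat \<Rightarrow> nat) \<Rightarrow> nat"
  assumes "i < n" "j < n"
  shows "(\<Sum>\<sigma>\<in>placements n. f (after_swap \<sigma> (i, j))) = (\<Sum>\<tau>\<in>placements n. f \<tau>)"
  unfolding after_swap_def placements_def
  using sum_permutations_compose_right[OF permutes_swap_id, of i "{..<n}" j f] assms by simp

text \<open>Alice's swap depends on \<sigma>, so the placement after it need not be uniform. The
  nonnegative excess \<open>f\<close> is therefore summed over all pairs of lockers, each giving a
  uniform placement. Only this excess, and not \<open>2 * m\<close>, picks up the factor
  \<open>n\<^sup>2\<close>.\<close>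

lemma sum_found_le:
  assumes a: "a \<in> alice_strategies n" and m: "m > 0" and n: "2 * m \<le> n"
  shows "(\<Sum>\<sigma>\<in>placements n. card {s \<in> {..<n}. bob_finds b1 b2 (after_swap \<sigma> (a \<sigma>)) s}) * (n - 2 * m) ^ m
    \<le> (2 * m * (n - 2 * m) ^ m + 2 * n\<^sup>2 * (n choose m) * 2 ^ m) * fact n"
proof -
  define f where "f \<tau> = (card {s \<in> {..<n}. ordered_find (<) b1 b2 \<tau> s} choose m)
    + (card {s \<in> {..<n}. ordered_find (>) b1 b2 \<tau> s} choose m)" for \<tau>
  define I where "I = {..<n} \<times> {..<n}"
  define K where "K = (n - 2 * m) ^ m"
  have card: "card (placements n) = fact n"
    unfolding placements_def by (rule card_permutations) auto
  have f: "(\<Sum>\<tau>\<in>placements n. f \<tau>) * K \<le> 2 * (n choose m) * 2 ^ m * fact n"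
    using sum_choose_ordered_find[of "(<)", OF _ n, of b1 b2] sum_choose_ordered_find[of "(>)", OF _ n, of b1 b2]
    by (simp add: f_def K_def sum.distrib add_mult_distrib)
  have "(\<Sum>\<sigma>\<in>placements n. card {s \<in> {..<n}. bob_finds b1 b2 (after_swap \<sigma> (a \<sigma>)) s})
      \<le> (\<Sum>\<sigma>\<in>placements n. 2 * m + (\<Sum>p\<in>I. f (after_swap \<sigma> p)))"
  proof (rule sum_mono)
    fix \<sigma> assume "\<sigma> \<in> placements n"
    then have "a \<sigma> \<in> I" using a by (auto simp: alice_strategies_def I_def)
    then have "f (after_swap \<sigma> (a \<sigma>)) \<le> (\<Sum>p\<in>I. f (after_swap \<sigma> p))"
      by (intro member_le_sum) (auto simp: I_def)
    then show "card {s \<in> {..<n}. bob_finds b1 b2 (after_swap \<sigma> (a \<sigma>)) s}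
        \<le> 2 * m + (\<Sum>p\<in>I. f (after_swap \<sigma> p))"
      using card_found_le[OF m, of n b1 b2 "after_swap \<sigma> (a \<sigma>)"] by (simp add: f_def)
  qed
  also have "\<dots> = fact n * (2 * m) + (\<Sum>p\<in>I. \<Sum>\<sigma>\<in>placements n. f (after_swap \<sigma> p))"
    by (simp add: sum.distrib card sum.swap[of _ I])
  also have "(\<Sum>p\<in>I. \<Sum>\<sigma>\<in>placements n. f (after_swap \<sigma> p)) = (\<Sum>p\<in>I. \<Sum>\<tau>\<in>placements n. f \<tau>)"
  proof (rule sum.cong[OF refl])
    fix p assume "p \<in> I"
    then show "(\<Sum>\<sigma>\<in>placements n. f (after_swap \<sigma> p)) = (\<Sum>\<tau>\<in>placements n. f \<tau>)"
      using sum_after_swap[of "fst p" n "snd p" f] by (auto simp: I_def)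
  qed
  also have "\<dots> = n\<^sup>2 * (\<Sum>\<tau>\<in>placements n. f \<tau>)"
    by (simp add: I_def power2_eq_square)
  finally have "(\<Sum>\<sigma>\<in>placements n. card {s \<in> {..<n}. bob_finds b1 b2 (after_swap \<sigma> (a \<sigma>)) s}) * K
      \<le> (fact n * (2 * m) + n\<^sup>2 * (\<Sum>\<tau>\<in>placements n. f \<tau>)) * K"
    by (rule mult_le_mono1)
  also have "\<dots> = fact n * (2 * m) * K + n\<^sup>2 * ((\<Sum>\<tau>\<in>placements n. f \<tau>) * K)"
    by (simp add: algebra_simps)
  also have "\<dots> \<le> fact n * (2 * m) * K + n\<^sup>2 * (2 * (n choose m) * 2 ^ m * fact n)"
    by (intro add_left_mono mult_le_mono2 f)
  also have "\<dots> = (2 * m * K + 2 * n\<^sup>2 * (n choose m) * 2 ^ m) * fact n"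
    by (simp add: algebra_simps)
  finally show ?thesis unfolding K_def .
qed

section \<open>From counting to the optimal probability\<close>

lemma success_prob_eq:
  assumes "n > 0"
  shows "success_prob n (a, b1, b2) =
    (\<Sum>\<sigma>\<in>placements n. card {s \<in> {..<n}. bob_finds b1 b2 (after_swap \<sigma> (a \<sigma>)) s}) / (fact n * n)"
proof -
  have fin: "finite (placements n)" and card: "card (placements n) = fact n"
    unfolding placements_def by (auto intro: finite_permutations card_permutations)
  have ne: "placements n \<noteq> {}" using card by (metis card.empty fact_nonzero)
  have "pair_pmf (pmf_of_set (placements n)) (pmf_of_set {..<n}) = pmf_of_set (placements n \<times> {..<n})"
  proof (rule pmf_eqI)
    fix p
    show "pmf (pair_pmf (pmf_of_set (placements n)) (pmf_of_set {..<n})) p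
        = pmf (pmf_of_set (placements n \<times> {..<n})) p"
      using assms fin ne lessThan_empty_iff[of n]
      by (cases p) (simp add: pmf_pair pmf_of_set card_cartesian_product indicator_def)
  qed
  moreover have "(placements n \<times> {..<n}) \<inter> {(\<sigma>, s). bob_finds b1 b2 (after_swap \<sigma> (a \<sigma>)) s} =
      (SIGMA \<sigma>:placements n. {s \<in> {..<n}. bob_finds b1 b2 (after_swap \<sigma> (a \<sigma>)) s})"
    by auto
  moreover have "placements n \<times> {..<n} \<noteq> {}" "finite (placements n \<times> {..<n})"
    using assms fin ne by (auto simp: lessThan_empty_iff)
  ultimately show ?thesis
    using fin card
    by (simp add: success_prob_def measure_pmf_of_set card_SigmaI card_cartesian_product)
qed

lemma clr_opt_prob_le:
  assumes m: "m > 0" and n: "4 * m \<le> n"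
  shows "clr_opt_prob n \<le> (2 * m + 2 * (real n)\<^sup>2 * 4 ^ m / fact m) / n"
proof -
  have n0: "n > 0" using m n by simp
  have "success_prob n x \<le> (2 * m + 2 * (real n)\<^sup>2 * 4 ^ m / fact m) / n" if "x \<in> clr_strategies n" for x
  proof -
    obtain a b1 b2 where x: "x = (a, b1, b2)" by (cases x)
    then have a: "a \<in> alice_strategies n" using that by (simp add: clr_strategies_def)
    define T where "T = (\<Sum>\<sigma>\<in>placements n. card {s \<in> {..<n}. bob_finds b1 b2 (after_swap \<sigma> (a \<sigma>)) s})"
    define K where "K = real (n - 2 * m) ^ m"
    have K: "K > 0" using m n by (simp add: K_def)
    have "T * (n - 2 * m) ^ m \<le> (2 * m * (n - 2 * m) ^ m + 2 * n\<^sup>2 * (n choose m) * 2 ^ m) * fact n"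
      unfolding T_def using sum_found_le[OF a m] n by simp
    then have "real (T * (n - 2 * m) ^ m) \<le>
        real ((2 * m * (n - 2 * m) ^ m + 2 * n\<^sup>2 * (n choose m) * 2 ^ m) * fact n)"
      by (rule of_nat_mono)
    then have "T * K \<le> (2 * m * K + 2 * n\<^sup>2 * real (n choose m) * 2 ^ m) * fact n"
      by (simp add: K_def)
    \<comment> \<open>The hypothesis \<open>4 * m \<le> n\<close> gives
      \<open>n - 2 * m \<ge> n / 2\<close>, which turns the base 2 into 4.\<close>
    moreover have "real (n choose m) * 2 ^ m \<le> 4 ^ m / fact m * K"
    proof -
      have "real ((n choose m) * fact m) \<le> real (n ^ m)"
        by (rule of_nat_mono[OF binomial_fact_pow])
      then have "real (n choose m) \<le> real n ^ m / fact m"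
        by (simp add: pos_le_divide_eq)
      then have "real (n choose m) * 2 ^ m \<le> real n ^ m / fact m * 2 ^ m"
        by (rule mult_right_mono) simp
      also have "\<dots> = (2 * real n) ^ m / fact m" by (simp add: power_mult_distrib)
      also have "\<dots> \<le> (4 * real (n - 2 * m)) ^ m / fact m"
        using n by (intro divide_right_mono power_mono) auto
      finally show ?thesis by (simp add: K_def power_mult_distrib)
    qed
    then have "2 * (real n)\<^sup>2 * (real (n choose m) * 2 ^ m) * fact n \<le> 2 * (real n)\<^sup>2 * (4 ^ m / fact m * K) * fact n"
      by (intro mult_right_mono mult_left_mono) auto
    ultimately have "T * K \<le> (2 * m + 2 * (real n)\<^sup>2 * 4 ^ m / fact m) * fact n * K"
      by (simp add: algebra_simps)
    then have "real T \<le> (2 * m + 2 * (real n)\<^sup>2 * 4 ^ m / fact m) * fact n"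
      using K by simp
    then show ?thesis
      unfolding x success_prob_eq[OF n0] T_def[symmetric] using n0 by (simp add: field_simps)
  qed
  then show ?thesis
    unfolding clr_opt_prob_def
    using finite_clr_strategies clr_strategies_nonempty[OF n0] by (intro Max.boundedI) auto
qed

section \<open>Asymptotics\<close>

text \<open>A single term of the exponential series at \<open>m\<close>; it replaces Stirling's
  formula.\<close>

lemma power_le_exp_times_fact: "real m ^ m \<le> exp (real m) * fact m"
proof -
  have "(\<Sum>k\<in>{m}. real m ^ k /\<^sub>R fact k) \<le> (\<Sum>k. real m ^ k /\<^sub>R fact k)"
    by (intro sum_le_suminf summable_exp_generic) auto
  then show ?thesis by (simp add: exp_def field_simps)
qed

lemma four_power_div_fact_le:
  assumes x: "0 < x" "x \<le> real m" and b: "0 \<le> b" "b \<le> x * (ln x - ln 4 - 1)"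
  shows "4 ^ m / fact m \<le> exp (- b)"
proof -
  have m: "m > 0" using x by (cases m) auto
  \<comment> \<open>This sign makes the product monotone, so that \<open>x\<close> may be replaced
    by the larger \<open>m\<close>.\<close>
  have "0 \<le> ln x - ln 4 - 1"
    using b x by (smt (verit) mult_pos_neg)
  moreover have "ln x \<le> ln (real m)" using x by simp
  ultimately have "x * (ln x - ln 4 - 1) \<le> real m * (ln (real m) - ln 4 - 1)"
    using x by (intro mult_mono) auto
  then have "b \<le> real m * (ln (real m) - ln 4 - 1)" using b by linarith
  then have "real m * ln 4 + real m + b \<le> real m * ln (real m)" by (simp add: algebra_simps)
  then have "exp (real m * ln 4 + real m + b) \<le> exp (real m * ln (real m))" by simp
  then have "4 ^ m * exp (real m) * exp b \<le> real m ^ m"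
    using m by (simp add: exp_add exp_of_nat_mult)
  also have "\<dots> \<le> exp (real m) * fact m" by (rule power_le_exp_times_fact)
  finally have "4 ^ m * exp b \<le> fact m" by (simp add: mult.commute mult.assoc)
  then show ?thesis by (simp add: exp_minus field_simps)
qed

text \<open>Since \<open>y n * ln (y n)\<close> is asymptotic to \<open>ln n\<close>, taking
  \<open>m\<close> near \<open>c * y n\<close> with \<open>c > 2\<close> makes
  \<open>4 ^ m / fact m\<close> at most \<open>1 / n\<^sup>2\<close>, which cancels the number of
  swaps. Of the allowance \<delta>, one half goes into \<open>2 * c\<close> and the other half
  absorbs \<open>4 / y n\<close>.\<close>

lemma eventually_clr_opt_prob_le:
  assumes \<delta>: "\<delta> > 0"
  shows "eventually (\<lambda>n. clr_opt_prob n * (n * log 2 (log 2 n)) / log 2 n \<le> 4 + \<delta>) at_top"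
proof -
  define y :: "nat \<Rightarrow> real" where "y n = log 2 n / log 2 (log 2 n)" for n
  define c where "c = 2 + \<delta> / 4"
  have c: "c > 2" using \<delta> by (simp add: c_def)
  have "((\<lambda>n. y n * (ln (y n) - ln 4 - 1) / ln n) \<longlongrightarrow> 1) at_top"
    unfolding y_def by real_asymp
  then have "eventually (\<lambda>n. 2 / c < y n * (ln (y n) - ln 4 - 1) / ln n) at_top"
    by (rule order_tendstoD) (use c in simp)
  \<comment> \<open>This will ensure \<open>4 * m \<le> n\<close>, because
    \<open>m < c * y n + 1\<close>.\<close>
  moreover have "((\<lambda>n. (y n + 1) / n) \<longlongrightarrow> 0) at_top"
    unfolding y_def by real_asymp
  then have "eventually (\<lambda>n. (y n + 1) / n < 1 / (4 * c)) at_top"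
    by (rule order_tendstoD) (use c in simp)
  moreover have "((\<lambda>n. 4 / y n) \<longlongrightarrow> 0) at_top"
    unfolding y_def by real_asymp
  then have "eventually (\<lambda>n. 4 / y n < \<delta> / 2) at_top"
    by (rule order_tendstoD) (use \<delta> in simp)
  moreover have "eventually (\<lambda>n. 0 < y n) at_top" unfolding y_def by real_asymp
  moreover have "eventually (\<lambda>n::nat. n \<ge> 2) at_top" by (rule eventually_ge_at_top)
  ultimately show ?thesis
  proof eventually_elim
    case (elim n)
    define x where "x = c * y n"
    define m where "m = nat \<lceil>x\<rceil>"
    have x: "0 < x" using elim c by (simp add: x_def)
    have m: "x \<le> real m" "real m < x + 1" "m > 0" using x by (auto simp: m_def) linarith
    have "real n > 0" "ln (real n) > 0" using elim by auto
    have "4 * (c * y n + c) < real n"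
      using elim(2) \<open>real n > 0\<close> c by (simp add: field_simps)
    then have "4 * m \<le> n" using m c by (simp add: x_def)
    have "2 * ln (real n) < c * y n * (ln (y n) - ln 4 - 1)"
      using elim(1) \<open>ln (real n) > 0\<close> c by (simp add: field_simps)
    also have "\<dots> \<le> x * (ln x - ln 4 - 1)"
      using c elim x unfolding x_def by (intro mult_left_mono) (auto simp: ln_mult)
    finally have "4 ^ m / fact m \<le> exp (- (2 * ln (real n)))"
      using x m \<open>ln (real n) > 0\<close> by (intro four_power_div_fact_le[of x]) auto
    also have "exp (- (2 * ln (real n))) = 1 / (real n)\<^sup>2"
      using \<open>real n > 0\<close> by (simp add: exp_minus exp_double field_simps)
    finally have "2 * (real n)\<^sup>2 * (4 ^ m / fact m) \<le> 2 * (real n)\<^sup>2 * (1 / (real n)\<^sup>2)"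
      by (intro mult_left_mono) auto
    \<comment> \<open>Rounding \<open>x\<close> up to \<open>m\<close> costs 2, and the swap term is
      at most another 2.\<close>
    then have *: "2 * m + 2 * (real n)\<^sup>2 * 4 ^ m / fact m \<le> 2 * x + 4"
      using m \<open>real n > 0\<close> by simp
    have "clr_opt_prob n \<le> (2 * x + 4) / n"
      using clr_opt_prob_le[OF \<open>m > 0\<close> \<open>4 * m \<le> n\<close>] divide_right_mono[OF *, of "real n"] by simp
    then have "clr_opt_prob n * real n \<le> 2 * x + 4"
      using \<open>real n > 0\<close> by (simp add: field_simps)
    then have "clr_opt_prob n * real n / y n \<le> (2 * x + 4) / y n"
      using elim by (intro divide_right_mono) auto
    also have "\<dots> = 2 * c + 4 / y n" using elim by (simp add: x_def field_simps)
    also have "\<dots> \<le> 4 + \<delta>" using elim by (simp add: c_def)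
    finally show ?case by (simp add: y_def)
  qed
qed

theorem theorem20:
  shows "\<exists>\<epsilon> :: nat \<Rightarrow> real. \<epsilon> \<longlonglongrightarrow> 0 \<and>
    (\<forall>n\<ge>3. clr_opt_prob n \<le> (4 + \<epsilon> n) * log 2 (real n) / (real n * log 2 (log 2 (real n))))"
proof (intro exI conjI allI impI)
  \<comment> \<open>The excess over 4 is cut off at 0, since only an upper estimate of the optimum
    is available.\<close>
  define \<epsilon> where "\<epsilon> n = max 0 (clr_opt_prob n * (n * log 2 (log 2 n)) / log 2 n - 4)" for n :: nat
  show "\<epsilon> \<longlonglongrightarrow> 0"
  proof (rule order_tendstoI)
    fix e :: real assume "e > 0"
    then have "eventually (\<lambda>n. clr_opt_prob n * (n * log 2 (log 2 n)) / log 2 n \<le> 4 + e / 2) at_top"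
      by (intro eventually_clr_opt_prob_le) simp
    then show "eventually (\<lambda>n. \<epsilon> n < e) at_top"
      by eventually_elim (use \<open>e > 0\<close> in \<open>simp add: \<epsilon>_def\<close>)
  next
    fix e :: real assume "e < 0"
    then show "eventually (\<lambda>n. e < \<epsilon> n) at_top"
      by (intro always_eventually allI) (simp add: \<epsilon>_def)
  qed
  fix n :: nat assume n: "3 \<le> n"
  \<comment> \<open>From \<open>n = 3\<close> on the iterated logarithm is positive; at
    \<open>n = 2\<close> it vanishes.\<close>
  have "log 2 (real n) > log 2 2" using n by (subst log_less_cancel_iff) auto
  then have L: "log 2 (real n) > 1" by simp
  then have LL: "log 2 (log 2 (real n)) > 0" by simp
  have "clr_opt_prob n * (n * log 2 (log 2 n)) / log 2 n \<le> 4 + \<epsilon> n"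
    by (simp add: \<epsilon>_def)
  then show "clr_opt_prob n \<le> (4 + \<epsilon> n) * log 2 (real n) / (real n * log 2 (log 2 (real n)))"
    using L LL n by (simp add: field_simps)
qed

end
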